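(* Let $p$ be a nonzero trim palindromic polynomial of darga $n$, with $\sigma$-coefficients $\sigma_1,\dots,\sigma_{\lfloor n/2\rfloor}$. Then (a) $\mathrm{il}(p)=\tfrac12\max\{-p(\omega):\omega\in V_n\}$; (b) $\mathrm{il}(p)=\max\Big\{\sum_{k=1}^{\lfloor n/2\rfloor}-\cos\frac{2\pi jk}{n}\,\sigma_k : j=0,1,\dots,\lfloor n/2\rfloor\Big\}$.
   Context: For a nonzero polynomial $p(x)=\sum_{j=r}^{s}p_jx^j$ with $p_r,p_s\neq 0$, its darga is $r+s$. A real polynomial of darga $n$ is palindromic if $p_j=p_{n-j}$ for all $j$; it is trim if $p(0)=0$, so it has the form $\sum_{j=1}^{n-1}p_jx^j$ with $p_j=p_{n-j}$. Its $\sigma$-coefficients are $\sigma_k=p_k$ for $1\le k<n/2$ and, if $n$ is even, $\sigma_{n/2}=p_{n/2}/2$, so that $p(x)=\sum_{k=1}^{\lfloor n/2\rfloor}\sigma_k(x^k+x^{n-k})$. Let $\theta_n=e^{2\pi i/n}$, $U_n=\{\theta_n^k:0\le k<n\}$, $V_n=\{\theta_n^k:0\le k\le n/2\}$. For real $\alpha$ put $p_\alpha(x)=\alpha(x^n+1)+p(x)$. A degree-$n$ polynomial strictly angle-interlaces $U_n$ if the arguments in $[0,2\pi)$ of its $n$ roots (with multiplicity) and of the points of $U_n$ are $2n$ distinct numbers alternating when sorted. The interlace number is $\mathrm{il}(p)=\inf\{\alpha>0:p_\alpha\text{ strictly angle-interlaces }U_n\}$. *)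

theory Defs
  imports "HOL-Analysis.Analysis" "HOL-Computational_Algebra.Polynomial"
begin

text \<open>Only meaningful for \<open>p \<noteq> 0\<close>, where the \<open>LEAST\<close> exists.\<close>
definition darga :: "real poly \<Rightarrow> nat" where
  "darga p = (LEAST j. coeff p j \<noteq> 0) + degree p"

text \<open>Coefficients beyond index \<open>darga p\<close> vanish, so the guard
  \<open>j \<le> darga p\<close> only avoids truncated subtraction.\<close>
definition palindromic :: "real poly \<Rightarrow> bool" where
  "palindromic p \<longleftrightarrow> (\<forall>j\<le>darga p. coeff p j = coeff p (darga p - j))"

definition trim :: "real poly \<Rightarrow> bool" where
  "trim p \<longleftrightarrow> poly p 0 = 0"

text \<open>Relevant for \<open>1 \<le> k \<le> n div 2\<close> with \<open>n = darga p\<close>.\<close>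
definition sigma_coeff :: "real poly \<Rightarrow> nat \<Rightarrow> real" where
  "sigma_coeff p k = (if 2 * k = darga p then coeff p k / 2 else coeff p k)"

definition theta :: "nat \<Rightarrow> complex" where
  "theta n = exp (2 * of_real pi * \<i> / of_nat n)"

definition U_pts :: "nat \<Rightarrow> complex set" where
  "U_pts n = {theta n ^ k | k. k < n}"

definition V_pts :: "nat \<Rightarrow> complex set" where
  "V_pts n = {theta n ^ k | k. real k \<le> real n / 2}"

definition p_shift :: "real poly \<Rightarrow> real \<Rightarrow> real poly" where
  "p_shift p \<alpha> = smult \<alpha> (monom 1 (darga p) + 1) + p"

definition root_args :: "real poly \<Rightarrow> real multiset" where
  "root_args q = image_mset Arg2pi (proots (map_poly complex_of_real q))"

definition U_args :: "nat \<Rightarrow> real multiset" where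
  "U_args n = image_mset Arg2pi (mset_set (U_pts n))"

text \<open>Since \<open>Arg2pi 0 = 0 = Arg2pi 1\<close> and \<open>1 \<in> U_pts n\<close>, distinctness rules out a root at \<open>0\<close>,
  whose argument is undefined mathematically.\<close>
definition strictly_angle_interlaces_U :: "real poly \<Rightarrow> nat \<Rightarrow> bool" where
  "strictly_angle_interlaces_U q n \<longleftrightarrow>
     degree q = n \<and>
     (let xs = sorted_list_of_multiset (root_args q + U_args n) in
        distinct xs \<and>
        (\<forall>i. Suc i < length xs \<longrightarrow> (xs ! i \<in># U_args n) \<noteq> (xs ! Suc i \<in># U_args n)))"

definition interlace_number :: "real poly \<Rightarrow> real" where
  "interlace_number p =
     Inf {\<alpha>. \<alpha> > 0 \<and> strictly_angle_interlaces_U (p_shift p \<alpha>) (darga p)}"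

text \<open>A palindromic polynomial of darga \<open>n\<close> takes real values at the \<open>n\<close>-th roots of unity,
  so that taking real parts of these values loses nothing.\<close>
lemma palindromic_real_at_root_of_unity:
  fixes p :: "real poly" and \<omega> :: complex
  assumes pal: "palindromic p" and root: "\<omega> ^ darga p = 1" and norm1: "norm \<omega> = 1"
  shows "poly (map_poly complex_of_real p) \<omega> \<in> \<real>"
proof -
  define n where "n = darga p"
  have deg: "degree (map_poly complex_of_real p) \<le> n"
    unfolding n_def darga_def by (simp add: degree_map_poly)
  have eval: "poly (map_poly complex_of_real p) z = (\<Sum>i\<le>n. of_real (coeff p i) * z ^ i)" for z
  proof -
    have "poly (map_poly complex_of_real p) z
            = (\<Sum>i\<le>n. coeff (map_poly complex_of_real p) i * z ^ i)"
      unfolding poly_altdef using deg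
      by (intro sum.mono_neutral_left) (auto simp: coeff_eq_0)
    then show ?thesis
      by (simp add: coeff_map_poly)
  qed
  have inv: "cnj \<omega> ^ i = \<omega> ^ (n - i)" if "i \<le> n" for i
  proof -
    have "\<omega> * cnj \<omega> = 1"
      using complex_norm_square[of \<omega>] norm1 by simp
    then have "\<omega> ^ i * cnj \<omega> ^ i = 1"
      by (simp flip: power_mult_distrib)
    moreover have "\<omega> ^ (n - i) * \<omega> ^ i = 1"
      using root that by (simp add: n_def flip: power_add)
    ultimately show ?thesis
      using mult.assoc[of "\<omega> ^ (n - i)" "\<omega> ^ i" "cnj \<omega> ^ i"] by simp
  qed
  have "cnj (poly (map_poly complex_of_real p) \<omega>) = (\<Sum>i\<le>n. of_real (coeff p i) * cnj \<omega> ^ i)"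
    unfolding eval by simp
  also have "\<dots> = (\<Sum>i\<le>n. of_real (coeff p (n - i)) * \<omega> ^ (n - i))"
  proof (rule sum.cong)
    fix i assume "i \<in> {..n}"
    then have "coeff p i = coeff p (n - i)" "cnj \<omega> ^ i = \<omega> ^ (n - i)"
      using pal inv[of i] unfolding palindromic_def n_def by blast+
    then show "of_real (coeff p i) * cnj \<omega> ^ i = of_real (coeff p (n - i)) * \<omega> ^ (n - i)"
      by (simp only:)
  qed simp
  also have "\<dots> = (\<Sum>i\<le>n. of_real (coeff p i) * \<omega> ^ i)"
    by (rule sum.reindex_bij_witness[where i = "\<lambda>i. n - i" and j = "\<lambda>i. n - i"]) auto
  finally show ?thesis
    unfolding eval by (simp add: Reals_cnj_iff)
qed

lemma palindromic_real_on_V_pts: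
  assumes "palindromic p" "\<omega> \<in> V_pts (darga p)"
  shows "poly (map_poly complex_of_real p) \<omega> \<in> \<real>"
proof (rule palindromic_real_at_root_of_unity[OF assms(1)])
  obtain k where k: "\<omega> = theta (darga p) ^ k" "real k \<le> real (darga p) / 2"
    using assms(2) by (auto simp: V_pts_def)
  have "theta (darga p) ^ darga p = 1"
  proof (cases "darga p = 0")
    case False
    then have "theta (darga p) ^ darga p = exp (2 * of_real pi * \<i>)"
      unfolding theta_def by (subst exp_of_nat_mult[symmetric]) simp
    then show ?thesis
      by simp
  qed simp
  then show "\<omega> ^ darga p = 1"
    unfolding k(1) by (subst power_mult[symmetric], subst mult.commute, subst power_mult) simp
  show "norm \<omega> = 1"
    by (simp add: k norm_power theta_def)
qed

end

theory Submission
  imports Defs "HOL-Computational_Algebra.Fundamental_Theorem_Algebra"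
begin

text \<open>
  Let \<open>q = p\<^sub>\<alpha>\<close>, so that \<open>q (\<theta> ^ j) = 2 \<alpha> + p (\<theta> ^ j)\<close> is real at the \<open>n\<close>-th roots of unity.
  The function \<open>exp (- \<i> n t / 2) * q (exp (\<i> t))\<close> is real and takes the value \<open>(-1) ^ j * q (\<theta> ^ j)\<close> at
  \<open>t = 2 \<pi> j / n\<close>. If all \<open>q (\<theta> ^ j)\<close> are positive, it changes sign between consecutive roots of unity,
  which locates all \<open>n\<close> roots of \<open>q\<close>. Conversely, interlacing forces the roots onto the unit circle (a
  root \<open>z\<close> off the circle shares its argument with the root \<open>1 / cnj z\<close>), one in each arc, so all
  \<open>q (\<theta> ^ j)\<close> have the same sign; their sum is \<open>2 \<alpha> n > 0\<close>, since the values of a trim polynomial at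
  the roots of unity sum to \<open>0\<close>. Hence \<open>p\<^sub>\<alpha>\<close> interlaces iff \<open>2 \<alpha> > - p (\<theta> ^ j)\<close> for all \<open>j\<close>. The resulting
  threshold is positive because the values \<open>p (\<theta> ^ j)\<close> sum to \<open>0\<close> without all vanishing, so the
  restriction to \<open>\<alpha> > 0\<close> in the infimum is harmless.
\<close>

section \<open>Interlacing with the roots of unity\<close>

text \<open>The index \<open>j = n\<close> is meaningful too: it gives \<open>2 * pi\<close>, the
  right end of the last arc, although \<open>theta n ^ n = 1\<close>.\<close>

definition unity_arg :: "nat \<Rightarrow> nat \<Rightarrow> real" where
  "unity_arg n j = 2 * pi * real j / real n"

lemma strict_mono_unity_arg: "n > 0 \<Longrightarrow> strict_mono (unity_arg n)"
  by (rule strict_monoI) (simp add: unity_arg_def divide_strict_right_mono)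

lemma theta_power: "theta n ^ k = cis (unity_arg n k)"
proof -
  have "theta n = cis (2 * pi / real n)"
    by (simp add: theta_def cis_conv_exp mult_ac)
  then have "theta n ^ k = cis (real k * (2 * pi / real n))"
    by (simp only: Complex.DeMoivre)
  then show ?thesis
    by (simp add: unity_arg_def mult_ac)
qed

lemma Arg2pi_cis: "0 \<le> t \<Longrightarrow> t < 2 * pi \<Longrightarrow> Arg2pi (cis t) = t"
  by (simp add: cis_conv_exp Arg2pi_exp)

lemma unity_arg_nonneg: "0 \<le> unity_arg n j"
  by (simp add: unity_arg_def)

lemma unity_arg_less_2pi: "j < n \<Longrightarrow> unity_arg n j < 2 * pi"
  by (simp add: unity_arg_def field_simps)

lemma inj_on_theta_power: "inj_on (\<lambda>k. theta n ^ k) {..<n}"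
proof (rule inj_onI)
  fix i j assume ij: "i \<in> {..<n}" "j \<in> {..<n}" "theta n ^ i = theta n ^ j"
  then have "unity_arg n i = unity_arg n j"
    using Arg2pi_cis[OF unity_arg_nonneg unity_arg_less_2pi] by (metis lessThan_iff theta_power)
  then show "i = j"
    using ij strict_mono_eq[OF strict_mono_unity_arg] by auto
qed

lemma U_args_eq: "U_args n = mset (map (unity_arg n) [0..<n])"
proof (cases "n = 0")
  case True
  then show ?thesis by (simp add: U_args_def U_pts_def)
next
  case False
  have "U_pts n = (\<lambda>k. theta n ^ k) ` {..<n}"
    by (auto simp: U_pts_def)
  then have "U_args n = image_mset (\<lambda>k. Arg2pi (theta n ^ k)) (mset_set {..<n})"
    unfolding U_args_def
    by (simp add: image_mset_mset_set[OF inj_on_theta_power, symmetric] multiset.map_comp comp_def)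
  also have "\<dots> = image_mset (unity_arg n) (mset_set {..<n})"
    by (rule image_mset_cong) (simp add: theta_power Arg2pi_cis unity_arg_nonneg unity_arg_less_2pi)
  also have "mset_set {..<n} = mset [0..<n]"
    by (simp add: atLeast0LessThan[symmetric])
  finally show ?thesis by simp
qed

section \<open>Alternating sorted lists as riffles of two sequences\<close>

text \<open>Lets a merged list be written down by parity of the index; both directions of the
  interlacing criterion compare multisets through it.\<close>

lemma mset_map_riffle:
  "mset (map (\<lambda>i. if even i then f (i div 2) else g (i div 2)) [0..<2 * n])
     = mset (map g [0..<n]) + mset (map f [0..<n])"
  by (induction n) simp_all

text \<open>The riffle \<open>t 0, \<phi> 0, t 1, \<phi> 1, ...\<close> is strictly increasing, so
  it is the sorted list itself. No \<open>\<phi> j\<close> is a value of \<open>t\<close>, as it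
  lies strictly between two consecutive ones; hence membership in \<open>B\<close> is parity of the
  index.\<close>

lemma alternating_of_separated:
  fixes t \<phi> :: "nat \<Rightarrow> 'a :: linorder"
  assumes t: "strict_mono t" and \<phi>: "\<And>j. j < n \<Longrightarrow> t j < \<phi> j \<and> \<phi> j < t (Suc j)"
  defines "B \<equiv> mset (map t [0..<n])"
  defines "xs \<equiv> sorted_list_of_multiset (mset (map \<phi> [0..<n]) + B)"
  shows "distinct xs" and "Suc i < length xs \<Longrightarrow> (xs ! i \<in># B) \<noteq> (xs ! Suc i \<in># B)"
proof -
  define h where "h i = (if even i then t (i div 2) else \<phi> (i div 2))" for i
  have "sorted_wrt (<) (map h [0..<2 * n])"
    unfolding sorted_wrt_iff_nth_Suc_transp[OF transp_on_less]
  proof (intro allI impI)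
    fix i assume "Suc i < length (map h [0..<2 * n])"
    then have "Suc i < 2 * n" by simp
    then show "map h [0..<2 * n] ! i < map h [0..<2 * n] ! Suc i"
      using \<phi>[of "i div 2"] by (auto simp: h_def)
  qed
  then have sd: "sorted (map h [0..<2 * n])" "distinct (map h [0..<2 * n])"
    by (simp_all only: strict_sorted_iff)
  have "xs = sorted_list_of_multiset (mset (map h [0..<2 * n]))"
    unfolding xs_def B_def h_def mset_map_riffle ..
  also have "\<dots> = map h [0..<2 * n]"
    using sd by (simp only: sorted_list_of_multiset_mset sorted_sort_id)
  finally have xs: "xs = map h [0..<2 * n]" .
  show "distinct xs" using sd by (simp only: xs)
  have "h j \<in># B \<longleftrightarrow> even j" if "j < 2 * n" for j
  proof
    assume "even j" then show "h j \<in># B" using that by (auto simp: B_def h_def)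
  next
    assume "h j \<in># B"
    then obtain k where k: "k < n" "h j = t k" by (auto simp: B_def)
    show "even j"
    proof (rule ccontr)
      assume "odd j"
      then have "t (j div 2) < t k" "t k < t (Suc (j div 2))"
        using \<phi>[of "j div 2"] k that by (auto simp: h_def)
      then show False
        using t by (simp add: strict_mono_less)
    qed
  qed
  then show "(xs ! i \<in># B) \<noteq> (xs ! Suc i \<in># B)" if "Suc i < length xs"
    using that by (simp add: xs)
qed

text \<open>The smallest entry is \<open>t 0\<close>, so alternation puts \<open>B\<close> exactly
  at the even positions, and the odd positions provide \<open>\<phi>\<close>.\<close>

lemma separated_of_alternating:
  fixes t :: "nat \<Rightarrow> 'a :: linorder"
  assumes t: "strict_mono t" and size: "size A = n"
    and bounds: "\<And>x. x \<in># A \<Longrightarrow> t 0 \<le> x \<and> x < t n"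
  defines "B \<equiv> mset (map t [0..<n])"
  defines "xs \<equiv> sorted_list_of_multiset (A + B)"
  assumes dist: "distinct xs"
    and alt: "\<And>i. Suc i < length xs \<Longrightarrow> (xs ! i \<in># B) \<noteq> (xs ! Suc i \<in># B)"
  obtains \<phi> where "\<And>j. j < n \<Longrightarrow> t j < \<phi> j \<and> \<phi> j < t (Suc j)" "A = mset (map \<phi> [0..<n])"
proof (cases "n = 0")
  case True
  then show ?thesis using that size by simp
next
  case False
  have mset_xs: "mset xs = A + B" by (simp add: xs_def)
  then have len: "length xs = 2 * n"
    by (metis B_def diff_zero length_map length_upt mset_append mult_2 size size_mset size_union)
  have sorted: "sorted_wrt (<) xs"
    using dist by (simp add: strict_sorted_iff xs_def)
  then have less: "xs ! i < xs ! j" if "i < j" "j < 2 * n" for i j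
    using that len by (simp add: sorted_wrt_iff_nth_less)
  have ge: "t 0 \<le> x" if "x \<in># A + B" for x
    using that bounds t by (auto simp: B_def strict_mono_less_eq)
  have "xs ! 0 = t 0"
  \<comment> \<open>\<open>t 0\<close> occurs in the list and bounds all entries from below, while
    the entry at index 0 is the strict minimum.\<close>
  proof -
    have "t 0 \<in> set xs"
      using False by (auto simp: B_def xs_def)
    then obtain i where "i < 2 * n" "xs ! i = t 0" by (auto simp: in_set_conv_nth len)
    moreover have "t 0 \<le> xs ! 0"
      using False len mset_xs ge by (metis mult_is_0 nth_mem neq0_conv set_mset_mset zero_neq_numeral)
    ultimately show ?thesis using less[of 0 i] by (cases "i = 0") auto
  qed
  then have parity: "xs ! i \<in># B \<longleftrightarrow> even i" if "i < 2 * n" for i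
    using that
  proof (induction i)
    case 0 then show ?case using False by (auto simp: B_def)
  next
    case (Suc i) then show ?case using alt[of i] len by auto
  qed
  \<comment> \<open>Two strictly increasing lists with the same set coincide. Inclusion of the sets
    is parity; equality follows by counting, both having \<open>n\<close> elements.\<close>
  have evens: "map (\<lambda>j. xs ! (2 * j)) [0..<n] = map t [0..<n]"
  proof (rule sorted_distinct_set_unique)
    have "sorted_wrt (<) (map (\<lambda>j. xs ! (2 * j)) [0..<n])"
      by (auto simp: sorted_wrt_iff_nth_less less)
    then show "sorted (map (\<lambda>j. xs ! (2 * j)) [0..<n])" and d: "distinct (map (\<lambda>j. xs ! (2 * j)) [0..<n])"
      by (simp_all only: strict_sorted_iff)
    have "sorted_wrt (<) (map t [0..<n])"
      using t by (auto simp: sorted_wrt_iff_nth_less strict_mono_less)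
    then show "sorted (map t [0..<n])" and d': "distinct (map t [0..<n])"
      by (simp_all only: strict_sorted_iff)
    have "set (map (\<lambda>j. xs ! (2 * j)) [0..<n]) \<subseteq> set (map t [0..<n])"
      using parity by (auto simp: B_def)
    moreover have "card (set (map (\<lambda>j. xs ! (2 * j)) [0..<n])) = card (set (map t [0..<n]))"
      using distinct_card[OF d] distinct_card[OF d'] by simp
    ultimately show "set (map (\<lambda>j. xs ! (2 * j)) [0..<n]) = set (map t [0..<n])"
      by (intro card_subset_eq) auto
  qed
  then have even_nth: "xs ! (2 * j) = t j" if "j < n" for j
    using that by (metis (no_types, lifting) diff_zero length_upt map_nth nth_map plus_nat.add_0 nth_upt)
  define \<phi> where "\<phi> j = xs ! Suc (2 * j)" for j
  have "mset xs = mset (map (\<lambda>i. if even i then t (i div 2) else \<phi> (i div 2)) [0..<2 * n])"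
  proof (rule arg_cong[where f = mset], rule nth_equalityI)
    fix i assume "i < length xs"
    then show "xs ! i = map (\<lambda>i. if even i then t (i div 2) else \<phi> (i div 2)) [0..<2 * n] ! i"
      using even_nth[of "i div 2"] by (auto simp: len \<phi>_def)
  qed (simp add: len)
  then have A: "A = mset (map \<phi> [0..<n])"
    using mset_xs unfolding mset_map_riffle B_def[symmetric] by simp
  show ?thesis
  proof (rule that[OF _ A], rule conjI)
    fix j assume j: "j < n"
    show "t j < \<phi> j"
      using less[of "2 * j" "Suc (2 * j)"] j even_nth by (simp add: \<phi>_def)
    show "\<phi> j < t (Suc j)"
    proof (cases "Suc j < n")
      case True
      then show ?thesis
        using less[of "Suc (2 * j)" "2 * Suc j"] even_nth[of "Suc j"] by (simp add: \<phi>_def)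
    next
      case False
      \<comment> \<open>The last gap has no element of \<open>B\<close> at its right end; the upper
        bound \<open>t n\<close> on \<open>A\<close> closes it.\<close>
      then have "Suc j = n" using j by simp
      then show ?thesis using bounds[of "\<phi> j"] j by (simp add: A)
    qed
  qed
qed

text \<open>Replaces the sorted list by one root argument per open arc. The bounds on
  \<open>A\<close> come from the range \<open>[0, 2 * pi)\<close> of \<open>Arg2pi\<close>.\<close>

lemma strictly_angle_interlaces_U_iff:
  assumes n: "n > 0"
  shows "strictly_angle_interlaces_U q n \<longleftrightarrow> degree q = n \<and>
    (\<exists>\<phi>. (\<forall>j<n. unity_arg n j < \<phi> j \<and> \<phi> j < unity_arg n (Suc j)) \<and>
         root_args q = mset (map \<phi> [0..<n]))"
proof (intro iffI conjI; (elim conjE exE)?)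
  assume L: "strictly_angle_interlaces_U q n"
  then show deg: "degree q = n" by (simp add: strictly_angle_interlaces_U_def)
  have "size (root_args q) = n"
    by (simp add: root_args_def size_proots_complex degree_map_poly deg)
  moreover have "unity_arg n 0 \<le> x \<and> x < unity_arg n n" if "x \<in># root_args q" for x
    using that n Arg2pi_ge_0 Arg2pi_lt_2pi by (auto simp: root_args_def unity_arg_def)
  ultimately obtain \<phi> where "\<And>j. j < n \<Longrightarrow> unity_arg n j < \<phi> j \<and> \<phi> j < unity_arg n (Suc j)"
      "root_args q = mset (map \<phi> [0..<n])"
    using separated_of_alternating[OF strict_mono_unity_arg[OF n], of "root_args q" n] L
    unfolding strictly_angle_interlaces_U_def U_args_eq Let_def by metis
  then show "\<exists>\<phi>. (\<forall>j<n. unity_arg n j < \<phi> j \<and> \<phi> j < unity_arg n (Suc j)) \<and>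
         root_args q = mset (map \<phi> [0..<n])"
    by blast
next
  fix \<phi> assume "degree q = n" "\<forall>j<n. unity_arg n j < \<phi> j \<and> \<phi> j < unity_arg n (Suc j)"
    "root_args q = mset (map \<phi> [0..<n])"
  then show "strictly_angle_interlaces_U q n"
    using alternating_of_separated[OF strict_mono_unity_arg[OF n], of n \<phi>]
    unfolding strictly_angle_interlaces_U_def U_args_eq Let_def by simp
qed

section \<open>Palindromic polynomials on the unit circle\<close>

abbreviation complex_poly :: "real poly \<Rightarrow> complex poly" where
  "complex_poly \<equiv> map_poly complex_of_real"

lemma poly_complex_poly:
  assumes "degree q \<le> n"
  shows "poly (complex_poly q) z = (\<Sum>i\<le>n. of_real (coeff q i) * z ^ i)"
proof -
  have "poly (complex_poly q) z = (\<Sum>i\<le>n. coeff (complex_poly q) i * z ^ i)"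
    unfolding poly_altdef using assms
    by (intro sum.mono_neutral_left) (auto simp: coeff_eq_0 degree_map_poly)
  then show ?thesis
    by (simp add: coeff_map_poly)
qed

text \<open>The real trigonometric polynomial \<open>exp (- \<i> n t / 2) * q (exp (\<i> t))\<close> of a palindromic \<open>q\<close>.\<close>

definition trig_poly :: "nat \<Rightarrow> real poly \<Rightarrow> real \<Rightarrow> real" where
  "trig_poly n q t = (\<Sum>i\<le>n. coeff q i * cos ((real i - real n / 2) * t))"

lemma poly_cis_eq_trig_poly:
  assumes deg: "degree q \<le> n" and pal: "\<And>i. i \<le> n \<Longrightarrow> coeff q i = coeff q (n - i)"
  shows "poly (complex_poly q) (cis t) = cis (real n * t / 2) * of_real (trig_poly n q t)"
proof -
  \<comment> \<open>The imaginary part left after removing the phase. Exchanging \<open>i\<close>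
    and \<open>n - i\<close> negates each sine, so \<open>S = - S\<close>.\<close>
  define S where "S = (\<Sum>i\<le>n. coeff q i * sin ((real i - real n / 2) * t))"
  have "S = (\<Sum>i\<le>n. - (coeff q i * sin ((real i - real n / 2) * t)))"
    unfolding S_def
  proof (rule sum.reindex_bij_witness[where i = "\<lambda>i. n - i" and j = "\<lambda>i. n - i"])
    fix i assume "i \<in> {..n}"
    then have "(real (n - i) - real n / 2) * t = - ((real i - real n / 2) * t)"
      by (simp add: algebra_simps)
    then show "- (coeff q (n - i) * sin ((real (n - i) - real n / 2) * t))
                 = coeff q i * sin ((real i - real n / 2) * t)"
      using pal[of i] \<open>i \<in> {..n}\<close> by simp
  qed auto
  then have "S = 0" by (simp add: sum_negf S_def)
  then have real: "(\<Sum>i\<le>n. of_real (coeff q i) * cis ((real i - real n / 2) * t)) = of_real (trig_poly n q t)"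
    by (simp add: complex_eq_iff trig_poly_def S_def)
  have "of_real (coeff q i) * cis t ^ i
          = cis (real n * t / 2) * (of_real (coeff q i) * cis ((real i - real n / 2) * t))" for i
    by (simp add: Complex.DeMoivre mult.left_commute cis_mult algebra_simps)
  then show ?thesis
    by (simp only: poly_complex_poly[OF deg] sum_distrib_left[symmetric] real)
qed

lemma poly_theta_power_eq_trig_poly:
  assumes "n > 0" "degree q \<le> n" "\<And>i. i \<le> n \<Longrightarrow> coeff q i = coeff q (n - i)"
  shows "Re (poly (complex_poly q) (theta n ^ j)) = (-1) ^ j * trig_poly n q (unity_arg n j)"
proof -
  have "cis (real n * unity_arg n j / 2) = (-1) ^ j"
    using \<open>n > 0\<close> by (simp add: unity_arg_def Complex.DeMoivre[symmetric] mult.commute[of pi])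
  then have "poly (complex_poly q) (theta n ^ j) = of_real ((-1) ^ j * trig_poly n q (unity_arg n j))"
    unfolding theta_power by (subst poly_cis_eq_trig_poly[OF assms(2,3)]) simp_all
  then show ?thesis by (simp only: Re_complex_of_real)
qed

lemma theta_power_n: "theta n ^ n = 1"
  by (cases "n = 0") (simp_all add: theta_power unity_arg_def)

section \<open>Positive values at the roots of unity force interlacing\<close>

lemma strictly_angle_interlaces_U_if_pos:
  assumes n: "n > 0" and deg: "degree q = n"
    and pal: "\<And>i. i \<le> n \<Longrightarrow> coeff q i = coeff q (n - i)"
    and pos: "\<And>j. j < n \<Longrightarrow> 0 < Re (poly (complex_poly q) (theta n ^ j))"
  shows "strictly_angle_interlaces_U q n"
proof -
  let ?F = "trig_poly n q" and ?t = "unity_arg n"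
  have sign: "0 < (-1) ^ j * ?F (?t j)" if "j \<le> n" for j
  proof -
    \<comment> \<open>The endpoint \<open>j = n\<close> is the point 1 again, so it is covered by
      the hypothesis at index 0.\<close>
    have "0 < Re (poly (complex_poly q) (theta n ^ j))"
      using pos[of j] pos[of 0] n that theta_power_n[of n] by (cases "j = n") auto
    then show ?thesis
      using poly_theta_power_eq_trig_poly[OF n eq_refl[OF deg] pal, of j] by simp
  qed
  have "\<exists>x. ?t j < x \<and> x < ?t (Suc j) \<and> ?F x = 0" if "j < n" for j
  proof -
    \<comment> \<open>The factor \<open>(-1) ^ j\<close> normalises the sign change to one from
      positive to negative.\<close>
    have "continuous_on {?t j..?t (Suc j)} (\<lambda>x. (-1) ^ j * ?F x)"
      unfolding trig_poly_def by (intro continuous_intros)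
    moreover have "0 < (-1) ^ j * ?F (?t j)" "(-1) ^ j * ?F (?t (Suc j)) < 0"
      using sign[of j] sign[of "Suc j"] that by simp_all
    moreover have "?t j \<le> ?t (Suc j)"
      using strict_mono_unity_arg[OF n] by (simp add: strict_mono_less_eq)
    ultimately obtain x where x: "?t j \<le> x" "x \<le> ?t (Suc j)" "(-1) ^ j * ?F x = 0"
      using IVT2'[of "\<lambda>x. (-1) ^ j * ?F x" "?t (Suc j)" 0 "?t j"] by auto
    moreover have "x \<noteq> ?t j" "x \<noteq> ?t (Suc j)"
      using x(3) sign[of j] sign[of "Suc j"] that by auto
    ultimately show ?thesis by (intro exI[of _ x]) auto
  qed
  then obtain \<phi> where \<phi>: "\<And>j. j < n \<Longrightarrow> ?t j < \<phi> j \<and> \<phi> j < ?t (Suc j) \<and> ?F (\<phi> j) = 0"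
    by metis
  have range: "0 \<le> \<phi> j" "\<phi> j < 2 * pi" if "j < n" for j
  proof -
    show "0 \<le> \<phi> j" using \<phi>[OF that] unity_arg_nonneg[of n j] by linarith
    have "?t (Suc j) \<le> ?t n"
      using strict_mono_unity_arg[OF n] that by (simp add: strict_mono_less_eq)
    also have "?t n = 2 * pi" using n by (simp add: unity_arg_def)
    finally show "\<phi> j < 2 * pi" using \<phi>[OF that] by linarith
  qed
  have arg: "Arg2pi (cis (\<phi> j)) = \<phi> j" if "j < n" for j
    using Arg2pi_cis range that by blast
  have inj: "inj_on (\<lambda>j. cis (\<phi> j)) {..<n}"
  proof (rule inj_onI)
    fix i j assume ij: "i \<in> {..<n}" "j \<in> {..<n}" "cis (\<phi> i) = cis (\<phi> j)"
    then have "\<phi> i = \<phi> j" using arg by (metis lessThan_iff)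
    then have "?t i < ?t (Suc j)" "?t j < ?t (Suc i)"
      using \<phi>[of i] \<phi>[of j] ij by auto
    then show "i = j"
      using strict_mono_unity_arg[OF n] by (simp add: strict_mono_less)
  qed
  have "q \<noteq> 0" using n deg by auto
  \<comment> \<open>The \<open>n\<close> distinct points found are all the roots, each simple,
    because \<open>proots\<close> has size \<open>n\<close>.\<close>
  have "mset_set ((\<lambda>j. cis (\<phi> j)) ` {..<n}) \<subseteq># proots (complex_poly q)"
  proof -
    have "(\<lambda>j. cis (\<phi> j)) ` {..<n} \<subseteq> set_mset (proots (complex_poly q))"
      using \<phi> \<open>q \<noteq> 0\<close> by (auto simp: poly_cis_eq_trig_poly[OF eq_refl[OF deg] pal] map_poly_eq_0_iff)
    then show ?thesis
      unfolding subseteq_mset_def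
      by (auto simp: count_mset_set' Suc_le_eq simp del: count_proots set_count_proots)
  qed
  moreover have "size (mset_set ((\<lambda>j. cis (\<phi> j)) ` {..<n})) = size (proots (complex_poly q))"
    by (simp add: size_proots_complex degree_map_poly deg card_image[OF inj])
  ultimately have "proots (complex_poly q) = mset_set ((\<lambda>j. cis (\<phi> j)) ` {..<n})"
    by (metis mset_subset_size order_less_irrefl subset_mset.nless_le)
  then have "root_args q = image_mset (\<lambda>j. Arg2pi (cis (\<phi> j))) (mset_set {..<n})"
    by (simp add: root_args_def image_mset_mset_set[OF inj, symmetric] multiset.map_comp comp_def)
  also have "\<dots> = image_mset \<phi> (mset_set {..<n})"
    by (rule image_mset_cong) (simp add: arg)
  also have "mset_set {..<n} = mset [0..<n]"
    by (simp add: atLeast0LessThan[symmetric])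
  finally have "root_args q = mset (map \<phi> [0..<n])" by simp
  then show ?thesis
    using \<phi> deg unfolding strictly_angle_interlaces_U_iff[OF n] by blast
qed

section \<open>Interlacing forces equal signs at the roots of unity\<close>

text \<open>Real coefficients allow conjugation and palindromicity reverses the exponents, so the
  nonzero roots are closed under reflection in the unit circle.\<close>

lemma poly_reflect:
  assumes deg: "degree q \<le> n" and pal: "\<And>i. i \<le> n \<Longrightarrow> coeff q i = coeff q (n - i)"
    and "z \<noteq> 0"
  shows "poly (complex_poly q) (inverse (cnj z)) = cnj (poly (complex_poly q) z) / cnj z ^ n"
proof -
  have "cnj z ^ n * poly (complex_poly q) (inverse (cnj z))
          = (\<Sum>i\<le>n. of_real (coeff q i) * (cnj z ^ n * inverse (cnj z) ^ i))"
    by (simp add: poly_complex_poly[OF deg] sum_distrib_left mult_ac)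
  also have "\<dots> = (\<Sum>i\<le>n. of_real (coeff q i) * cnj z ^ i)"
  proof (rule sum.reindex_bij_witness[where i = "\<lambda>i. n - i" and j = "\<lambda>i. n - i"])
    fix i assume "i \<in> {..n}"
    then have "cnj z ^ n * inverse (cnj z) ^ i = cnj z ^ (n - i)"
      using \<open>z \<noteq> 0\<close> by (simp add: power_diff divide_inverse power_inverse)
    then show "of_real (coeff q (n - i)) * cnj z ^ (n - i)
                 = of_real (coeff q i) * (cnj z ^ n * inverse (cnj z) ^ i)"
      using pal[of i] \<open>i \<in> {..n}\<close> by simp
  qed auto
  also have "\<dots> = cnj (poly (complex_poly q) z)"
    by (simp add: poly_complex_poly[OF deg])
  finally show ?thesis using \<open>z \<noteq> 0\<close> by (simp add: field_simps)
qed

lemma root_on_unit_circle: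
  assumes deg: "degree q \<le> n" and pal: "\<And>i. i \<le> n \<Longrightarrow> coeff q i = coeff q (n - i)"
    and dist: "root_args q = mset xs" "distinct xs"
    and root: "z \<in># proots (complex_poly q)" and "z \<noteq> 0"
  shows "z = cis (Arg2pi z)"
proof -
  have "q \<noteq> 0" using root by auto
  define w where "w = inverse (cnj z)"
  \<comment> \<open>The reflected root is a positive multiple of \<open>z\<close>, hence has the
    same argument.\<close>
  have w: "w = of_real (inverse ((cmod z)\<^sup>2)) * z"
    using \<open>z \<noteq> 0\<close> complex_norm_square[of z] by (simp add: w_def field_simps)
  have "w \<in># proots (complex_poly q)"
    using poly_reflect[OF deg pal \<open>z \<noteq> 0\<close>] root \<open>q \<noteq> 0\<close>
    by (simp add: w_def map_poly_eq_0_iff)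
  moreover have "Arg2pi w = Arg2pi z"
    unfolding w using \<open>z \<noteq> 0\<close> by (intro Arg2pi_times_of_real) simp
  moreover have "w = z"
  proof (rule ccontr)
    assume "w \<noteq> z"
    \<comment> \<open>Two different roots with one argument give that argument multiplicity at least
      2, against distinctness.\<close>
    then have "{#w, z#} \<subseteq># proots (complex_poly q)"
      using root \<open>w \<in># _\<close> by (simp add: insert_subset_eq_iff in_diff_count del: set_count_proots count_proots)
    then have "image_mset Arg2pi {#w, z#} \<subseteq># root_args q"
      unfolding root_args_def by (rule image_mset_subseteq_mono)
    then have "count (mset xs) (Arg2pi z) \<ge> 2"
      using \<open>Arg2pi w = Arg2pi z\<close> mset_subset_eq_count[of "{#Arg2pi z, Arg2pi z#}" "mset xs" "Arg2pi z"] dist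
      by simp
    then show False
      using dist(2) by (simp add: distinct_count_atmost_1 split: if_splits)
  qed
  then have "inverse ((cmod z)\<^sup>2) = 1"
    using w \<open>z \<noteq> 0\<close> by (metis mult_cancel_right1 of_real_eq_1_iff)
  then have "cmod z = 1"
    using norm_ge_zero[of z] by (auto simp: power2_eq_1_iff)
  then show ?thesis
    using Arg2pi_eq[of z] by (simp add: cis_conv_exp)
qed

text \<open>Separates a linear factor at a root on the circle into a phase and a real sine, whose
  sign can be read off.\<close>

lemma cis_diff_eq_sin: "cis a - cis b = 2 * \<i> * cis ((a + b) / 2) * of_real (sin ((a - b) / 2))"
proof -
  have ab: "a = (a + b) / 2 + (a - b) / 2" "b = (a + b) / 2 + - ((a - b) / 2)"
    by (simp_all add: field_simps)
  have "cis a - cis b = cis ((a + b) / 2) * (cis ((a - b) / 2) - cis (- ((a - b) / 2)))"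
    by (metis ab cis_mult right_diff_distrib)
  also have "cis ((a - b) / 2) - cis (- ((a - b) / 2)) = 2 * \<i> * of_real (sin ((a - b) / 2))"
    by (simp add: complex_eq_iff)
  finally show ?thesis by simp
qed

text \<open>Factoring \<open>q (exp (\<i> t))\<close> over the roots \<open>exp (\<i> \<phi>\<^sub>k)\<close> gives, up to a constant,
  \<open>exp (\<i> n t / 2)\<close> times the product of the \<open>sin ((t - \<phi>\<^sub>k) / 2)\<close>, whose sign at the \<open>j\<close>-th root of
  unity is \<open>(-1) ^ (n - j)\<close> by interlacing; the first factor there is \<open>(-1) ^ j\<close>.\<close>

lemma same_sign_if_strictly_angle_interlaces_U:
  assumes n: "n > 0" and pal: "\<And>i. i \<le> n \<Longrightarrow> coeff q i = coeff q (n - i)"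
    and inter: "strictly_angle_interlaces_U q n"
  obtains K R where "\<And>j. j < n \<Longrightarrow> R j > 0"
    "\<And>j. j < n \<Longrightarrow> Re (poly (complex_poly q) (theta n ^ j)) = K * R j"
proof -
  let ?t = "unity_arg n"
  obtain \<phi> where deg: "degree q = n" and \<phi>: "\<And>j. j < n \<Longrightarrow> ?t j < \<phi> j \<and> \<phi> j < ?t (Suc j)"
    and args: "root_args q = mset (map \<phi> [0..<n])"
    using inter unfolding strictly_angle_interlaces_U_iff[OF n] by blast
  have mono: "?t i \<le> ?t j" if "i \<le> j" for i j
    using strict_mono_unity_arg[OF n] that by (simp add: strict_mono_less_eq)
  have less: "\<phi> i < \<phi> j" if "i < j" "j < n" for i j
    using \<phi>[of i] \<phi>[of j] mono[of "Suc i" j] that by linarith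
  have dist: "distinct (map \<phi> [0..<n])"
    unfolding distinct_map using less by (auto simp: inj_on_def) (metis linorder_neqE_nat order_less_irrefl)
  have pos: "0 < \<phi> j" if "j < n" for j
    using \<phi>[OF that] unity_arg_nonneg[of n j] by linarith
  have lt: "\<phi> j < 2 * pi" if "j < n" for j
    using \<phi>[OF that] mono[of "Suc j" n] that n by (simp add: unity_arg_def)
  define L where "L = lead_coeff (complex_poly q)"
  have circle: "z = cis (Arg2pi z)" if "z \<in># proots (complex_poly q)" for z
  proof (rule root_on_unit_circle[OF _ pal args dist that])
    have "Arg2pi z \<in># root_args q" using that by (simp add: root_args_def)
    \<comment> \<open>\<open>Arg2pi 0 = 0\<close> by convention, whereas every root argument
      \<open>\<phi> j\<close> is positive.\<close>
    then show "z \<noteq> 0" unfolding args using pos by force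
  qed (simp_all add: deg)
  have prod: "poly (complex_poly q) z = L * (\<Prod>k<n. z - cis (\<phi> k))" for z
  proof -
    have "poly (complex_poly q) z = L * (\<Prod>x\<in>#proots (complex_poly q). z - x)"
      by (subst complex_poly_decompose_multiset[symmetric])
         (simp add: L_def poly_prod_mset multiset.map_comp comp_def)
    also have "image_mset (\<lambda>x. z - x) (proots (complex_poly q))
        = image_mset (\<lambda>x. z - cis (Arg2pi x)) (proots (complex_poly q))"
      by (rule image_mset_cong) (use circle in auto)
    also have "\<dots> = image_mset (\<lambda>x. z - cis x) (root_args q)"
      by (simp add: root_args_def multiset.map_comp comp_def)
    also have "prod_mset \<dots> = (\<Prod>k<n. z - cis (\<phi> k))"
      by (simp add: args multiset.map_comp comp_def prod_unfold_prod_mset atLeast0LessThan[symmetric] del: mset_map mset_upt)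
         (simp add: multiset.map_comp comp_def)
    finally show ?thesis .
  qed
  \<comment> \<open>Collects everything independent of \<open>t\<close>; the remaining phases
    \<open>cis (t / 2)\<close> multiply to \<open>cis (real n * t / 2)\<close>, which
    cancels.\<close>
  define C where "C = L * (\<Prod>k<n. 2 * \<i> * cis (\<phi> k / 2))"
  have trig: "of_real (trig_poly n q t) = C * of_real (\<Prod>k<n. sin ((t - \<phi> k) / 2))" for t
  proof -
    have "poly (complex_poly q) (cis t)
        = L * (\<Prod>k<n. cis (t / 2) * ((2 * \<i> * cis (\<phi> k / 2)) * of_real (sin ((t - \<phi> k) / 2))))"
      unfolding prod cis_diff_eq_sin by (simp add: add_divide_distrib cis_mult[symmetric] mult_ac)
    also have "\<dots> = cis (real n * t / 2) * (C * of_real (\<Prod>k<n. sin ((t - \<phi> k) / 2)))"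
      by (simp add: prod.distrib C_def Complex.DeMoivre)
    finally show ?thesis
      by (simp add: poly_cis_eq_trig_poly[OF eq_refl[OF deg] pal])
  qed
  define R where "R j = (-1) ^ (n - j) * (\<Prod>k<n. sin ((?t j - \<phi> k) / 2))" for j
  have Rpos: "R j > 0" if j: "j < n" for j
  proof -
    have "(\<Prod>k<n. sin ((?t j - \<phi> k) / 2))
            = (\<Prod>k<j. sin ((?t j - \<phi> k) / 2)) * (\<Prod>k\<in>{j..<n}. sin ((?t j - \<phi> k) / 2))"
      using j by (simp add: prod.atLeastLessThan_concat lessThan_atLeast0)
    also have "(\<Prod>k\<in>{j..<n}. sin ((?t j - \<phi> k) / 2)) = (\<Prod>k\<in>{j..<n}. - 1 * sin ((\<phi> k - ?t j) / 2))"
      by (rule prod.cong) (simp_all, metis sin_minus minus_diff_eq minus_divide_left)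
    also have "\<dots> = (-1) ^ (n - j) * (\<Prod>k\<in>{j..<n}. sin ((\<phi> k - ?t j) / 2))"
      by (simp only: prod.distrib prod_constant card_atLeastLessThan)
    finally have "R j = (\<Prod>k<j. sin ((?t j - \<phi> k) / 2)) * (\<Prod>k\<in>{j..<n}. sin ((\<phi> k - ?t j) / 2))"
      by (simp add: R_def)
    moreover have "(\<Prod>k<j. sin ((?t j - \<phi> k) / 2)) > 0"
    proof (intro prod_pos ballI sin_gt_zero)
      fix k assume "k \<in> {..<j}"
      then show "0 < (?t j - \<phi> k) / 2" "(?t j - \<phi> k) / 2 < pi"
        using \<phi>[of k] mono[of "Suc k" j] j pos[of k] unity_arg_less_2pi[of j n] by auto
    qed
    moreover have "(\<Prod>k\<in>{j..<n}. sin ((\<phi> k - ?t j) / 2)) > 0"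
    proof (intro prod_pos ballI sin_gt_zero)
      fix k assume "k \<in> {j..<n}"
      then show "0 < (\<phi> k - ?t j) / 2" "(\<phi> k - ?t j) / 2 < pi"
        using \<phi>[of k] mono[of j k] lt[of k] unity_arg_nonneg[of n j] by auto
    qed
    ultimately show ?thesis by simp
  qed
  \<comment> \<open>Whether \<open>C\<close> is real need not be decided: \<open>R j\<close> is
    real, so only the real part of the constant enters.\<close>
  have "Re (poly (complex_poly q) (theta n ^ j)) = Re ((-1) ^ n * C) * R j" if "j < n" for j
  proof -
    have "(-1) ^ j * (-1) ^ (n - j) = (-1 :: complex) ^ n"
      using that by (simp flip: power_add)
    \<comment> \<open>Trades \<open>(-1) ^ j\<close> for the sign built into \<open>R j\<close>; the
      cost \<open>(-1) ^ n\<close> does not depend on \<open>j\<close>.\<close>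
    then have s: "(-1) ^ j = (-1 :: complex) ^ n * (-1) ^ (n - j)"
      by (metis (no_types, lifting) left_minus_one_mult_self mult.assoc mult.commute)
    have "of_real ((-1) ^ j * trig_poly n q (?t j)) = (-1) ^ n * C * of_real (R j)"
      by (simp add: trig R_def s)
    then have "(-1) ^ j * trig_poly n q (?t j) = Re ((-1) ^ n * C * of_real (R j))"
      by (metis Re_complex_of_real)
    then show ?thesis
      using poly_theta_power_eq_trig_poly[OF n eq_refl[OF deg] pal, of j] by simp
  qed
  with Rpos show ?thesis by (rule that)
qed

section \<open>The interlace number\<close>

definition unity_value :: "real poly \<Rightarrow> nat \<Rightarrow> real" where
  "unity_value p j = Re (poly (complex_poly p) (theta (darga p) ^ j))"

text \<open>Coefficient 0 vanishes, so the least nonzero index is positive. Thus \<open>p\<close>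
  has no coefficient at either position changed by the shift, and
  \<open>darga p > 0\<close>.\<close>

lemma degree_less_darga:
  assumes "p \<noteq> 0" "trim p"
  shows "degree p < darga p"
proof -
  have "coeff p (degree p) \<noteq> 0" using \<open>p \<noteq> 0\<close> by simp
  then have "coeff p (LEAST j. coeff p j \<noteq> 0) \<noteq> 0" by (rule LeastI)
  moreover have "coeff p 0 = 0" using \<open>trim p\<close> by (simp add: trim_def poly_0_coeff_0)
  ultimately have "(LEAST j. coeff p j \<noteq> 0) \<noteq> 0" by metis
  then show ?thesis by (simp add: darga_def)
qed

lemma coeff_p_shift:
  "coeff (p_shift p \<alpha>) i
     = \<alpha> * ((if i = darga p then 1 else 0) + (if i = 0 then 1 else 0)) + coeff p i"
  by (auto simp: p_shift_def coeff_1)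

lemma degree_p_shift:
  assumes "p \<noteq> 0" "trim p" "\<alpha> \<noteq> 0"
  shows "degree (p_shift p \<alpha>) = darga p"
proof (rule antisym)
  have d: "degree p < darga p" using degree_less_darga assms by blast
  show "degree (p_shift p \<alpha>) \<le> darga p"
    by (rule degree_le) (use d in \<open>auto simp: coeff_p_shift coeff_eq_0\<close>)
  show "darga p \<le> degree (p_shift p \<alpha>)"
    by (rule le_degree) (use d \<open>\<alpha> \<noteq> 0\<close> in \<open>auto simp: coeff_p_shift coeff_eq_0\<close>)
qed

lemma coeff_p_shift_palindromic:
  assumes "palindromic p" "i \<le> darga p"
  shows "coeff (p_shift p \<alpha>) i = coeff (p_shift p \<alpha>) (darga p - i)"
proof -
  have "coeff p i = coeff p (darga p - i)"
    using assms unfolding palindromic_def by blast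
  then show ?thesis using assms(2) by (auto simp: coeff_p_shift)
qed

lemma p_shift_at_theta_power:
  assumes "p \<noteq> 0" "trim p" "\<alpha> \<noteq> 0"
  shows "Re (poly (complex_poly (p_shift p \<alpha>)) (theta (darga p) ^ j)) = 2 * \<alpha> + unity_value p j"
proof -
  have "complex_poly (p_shift p \<alpha>) = smult (of_real \<alpha>) (monom 1 (darga p) + 1) + complex_poly p"
    by (rule poly_eqI) (auto simp: coeff_p_shift coeff_map_poly coeff_1)
  moreover have "(theta (darga p) ^ j) ^ darga p = 1"
    by (metis power_mult mult.commute power_one theta_power_n)
  ultimately show ?thesis
    by (simp add: unity_value_def poly_monom)
qed

lemma sum_theta_powers:
  assumes "0 < i" "i < n"
  shows "(\<Sum>j<n. (theta n ^ j) ^ i) = 0"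
proof -
  have "theta n ^ i \<noteq> theta n ^ 0"
    using inj_on_theta_power[of n] assms unfolding inj_on_def by (metis lessThan_iff less_trans order_less_irrefl)
  moreover have "(theta n ^ i) ^ n = 1"
    by (metis power_mult mult.commute power_one theta_power_n)
  ultimately have "(\<Sum>j<n. (theta n ^ i) ^ j) = 0"
    by (simp add: geometric_sum)
  then show ?thesis
    by (simp add: power_mult[symmetric] mult.commute)
qed

text \<open>The powers with exponent strictly between 0 and \<open>n\<close> sum to 0 over the roots
  of unity, and a trim polynomial has only such exponents.\<close>

lemma sum_unity_value:
  assumes "p \<noteq> 0" "trim p"
  shows "(\<Sum>j<darga p. unity_value p j) = 0"
proof -
  define n where "n = darga p"
  have d: "degree p < n" using degree_less_darga[OF assms] by (simp add: n_def)
  have "(\<Sum>j<n. poly (complex_poly p) (theta n ^ j))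
          = (\<Sum>i\<le>n. of_real (coeff p i) * (\<Sum>j<n. (theta n ^ j) ^ i))"
    by (simp add: poly_complex_poly[OF less_imp_le[OF d]] sum_distrib_left sum.swap[of _ "{..n}"])
  also have "\<dots> = 0"
  proof (rule sum.neutral, rule ballI)
    fix i assume "i \<in> {..n}"
    then consider "i = 0" | "i = n" | "0 < i" "i < n" by fastforce
    then show "of_real (coeff p i) * (\<Sum>j<n. (theta n ^ j) ^ i) = 0"
    proof cases
      case 1 then show ?thesis using \<open>trim p\<close> by (simp add: trim_def poly_0_coeff_0)
    next
      case 2 then show ?thesis using d by (simp add: coeff_eq_0)
    next
      case 3 then show ?thesis by (simp add: sum_theta_powers)
    qed
  qed
  finally have "Re (\<Sum>j<n. poly (complex_poly p) (theta n ^ j)) = 0" by simp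
  then show ?thesis by (simp add: unity_value_def n_def)
qed

text \<open>Otherwise nonnegative terms sum to 0, all vanish, and \<open>p\<close> has
  \<open>darga p\<close> distinct roots, more than its degree.\<close>

lemma unity_value_neg:
  assumes "p \<noteq> 0" "trim p" "palindromic p"
  obtains j where "j < darga p" "unity_value p j < 0"
proof (rule ccontr)
  define n where "n = darga p"
  assume "\<not> thesis"
  then have "\<forall>j\<in>{..<n}. 0 \<le> unity_value p j"
    using that by (force simp: n_def)
  then have zero: "unity_value p j = 0" if "j < n" for j
    using sum_unity_value[OF assms(1,2)] that sum_nonneg_eq_0_iff[of "{..<n}" "unity_value p"]
    by (auto simp: n_def)
  have "poly (complex_poly p) (theta n ^ j) = 0" if "j < n" for j
  proof -
    \<comment> \<open>Only the real part is known to vanish; palindromicity makes the value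
      real.\<close>
    have "poly (complex_poly p) (theta n ^ j) \<in> \<real>"
    proof (rule palindromic_real_at_root_of_unity[OF assms(3)])
      show "(theta n ^ j) ^ darga p = 1"
        unfolding n_def by (metis power_mult mult.commute power_one theta_power_n)
      show "cmod (theta n ^ j) = 1" by (simp add: theta_power)
    qed
    then show ?thesis
      using zero[OF that] by (simp add: unity_value_def n_def complex_is_Real_iff complex_eq_iff)
  qed
  then have "(\<lambda>j. theta n ^ j) ` {..<n} \<subseteq> {z. poly (complex_poly p) z = 0}" by auto
  moreover have nz: "complex_poly p \<noteq> 0" using \<open>p \<noteq> 0\<close> by (simp add: map_poly_eq_0_iff)
  ultimately have "card ((\<lambda>j. theta n ^ j) ` {..<n}) \<le> card {z. poly (complex_poly p) z = 0}"
    by (intro card_mono poly_roots_finite)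
  also have "\<dots> \<le> degree p"
    using card_poly_roots_bound[OF nz] by (simp add: degree_map_poly)
  finally show False
    using degree_less_darga[OF assms(1,2)] by (simp add: card_image[OF inj_on_theta_power] n_def)
qed

lemma strictly_angle_interlaces_p_shift_iff:
  assumes "p \<noteq> 0" "trim p" "palindromic p" "\<alpha> > 0"
  shows "strictly_angle_interlaces_U (p_shift p \<alpha>) (darga p)
           \<longleftrightarrow> (\<forall>j<darga p. 0 < 2 * \<alpha> + unity_value p j)"
proof
  have n: "darga p > 0" using degree_less_darga[OF assms(1,2)] by simp
  note val = p_shift_at_theta_power[OF assms(1,2) less_imp_neq[OF assms(4), symmetric]]
  note pal = coeff_p_shift_palindromic[OF assms(3)]
  {
    assume inter: "strictly_angle_interlaces_U (p_shift p \<alpha>) (darga p)"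
    obtain K R where R: "\<And>j. j < darga p \<Longrightarrow> R j > 0"
      and KR: "\<And>j. j < darga p \<Longrightarrow> 2 * \<alpha> + unity_value p j = K * R j"
      using same_sign_if_strictly_angle_interlaces_U[OF n pal inter] unfolding val by metis
    \<comment> \<open>Summing over \<open>j\<close> determines the common sign, as the contributions
      of \<open>p\<close> cancel.\<close>
    have "K * (\<Sum>j<darga p. R j) = (\<Sum>j<darga p. 2 * \<alpha> + unity_value p j)"
      by (simp add: KR sum_distrib_left)
    also have "\<dots> = 2 * \<alpha> * real (darga p)"
      using sum_unity_value[OF assms(1,2)] by (simp add: sum.distrib)
    finally have "0 < K * (\<Sum>j<darga p. R j)" using \<open>\<alpha> > 0\<close> n by simp
    moreover have "0 \<le> (\<Sum>j<darga p. R j)" using R by (intro sum_nonneg) (simp add: less_imp_le)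
    ultimately have "K > 0" by (simp add: zero_less_mult_iff)
    then show "\<forall>j<darga p. 0 < 2 * \<alpha> + unity_value p j" using KR R by simp
  }
  assume "\<forall>j<darga p. 0 < 2 * \<alpha> + unity_value p j"
  then show "strictly_angle_interlaces_U (p_shift p \<alpha>) (darga p)"
    using degree_p_shift[OF assms(1,2)] \<open>\<alpha> > 0\<close>
    by (intro strictly_angle_interlaces_U_if_pos[OF n _ pal]) (auto simp: val)
qed

section \<open>Cosine sums and the symmetry of the values\<close>

lemma unity_value_eq:
  assumes "degree p \<le> darga p"
  shows "unity_value p j = (\<Sum>i\<le>darga p. coeff p i * cos (2 * pi * real j * real i / real (darga p)))"
  by (simp add: unity_value_def poly_complex_poly[OF assms] theta_power Complex.DeMoivre unity_arg_def mult_ac)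

text \<open>\<open>theta n ^ (n - j)\<close> is the conjugate of \<open>theta n ^ j\<close> and the
  coefficients are real. This reduces the maximum over all roots of unity to the half
  \<open>V_pts\<close>.\<close>

lemma unity_value_reflect:
  assumes "j \<le> darga p"
  shows "unity_value p (darga p - j) = unity_value p j"
proof -
  define n where "n = darga p"
  have "theta n ^ (n - j) * theta n ^ j = 1"
    using assms by (simp add: n_def theta_power_n flip: power_add)
  moreover have "cnj (theta n ^ j) * theta n ^ j = 1"
    by (simp add: theta_power cis_cnj cis_mult)
  ultimately have "theta n ^ (n - j) = cnj (theta n ^ j)"
    by (metis mult_cancel_right mult_zero_right zero_neq_one)
  moreover have "poly (complex_poly p) (cnj z) = cnj (poly (complex_poly p) z)" for z
    by (simp add: poly_complex_poly[OF order_refl])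
  ultimately have "poly (complex_poly p) (theta n ^ (n - j)) = cnj (poly (complex_poly p) (theta n ^ j))"
    by (simp only:)
  then show ?thesis
    by (simp add: unity_value_def n_def)
qed

text \<open>Folds \<open>i\<close> onto \<open>n - i\<close>. For even \<open>n\<close> the middle
  term is its own partner and occurs once, hence the halving that reappears in
  \<open>sigma_coeff\<close>.\<close>

lemma sum_symmetric:
  fixes f :: "nat \<Rightarrow> 'a :: field_char_0"
  assumes sym: "\<And>i. i \<le> n \<Longrightarrow> f i = f (n - i)" and "f 0 = 0"
  shows "(\<Sum>i\<le>n. f i) = 2 * (\<Sum>k = 1..n div 2. if 2 * k = n then f k / 2 else f k)"
proof -
  have "(\<Sum>i\<le>n. f i) = (\<Sum>i\<le>n div 2. f i) + (\<Sum>i\<in>{n div 2<..n}. f i)"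
    by (subst sum.union_disjoint[symmetric]) (auto intro!: sum.cong)
  also have "(\<Sum>i\<in>{n div 2<..n}. f i) = (\<Sum>k | k \<le> n div 2 \<and> 2 * k \<noteq> n. f k)"
    by (intro sum.reindex_bij_witness[where i = "\<lambda>i. n - i" and j = "\<lambda>i. n - i"])
       (auto simp: sym[symmetric])
  also have "\<dots> = (\<Sum>k\<le>n div 2. if 2 * k = n then 0 else f k)"
    by (rule sum.mono_neutral_cong_left) auto
  also have "(\<Sum>i\<le>n div 2. f i) + \<dots> = (\<Sum>k\<le>n div 2. 2 * (if 2 * k = n then f k / 2 else f k))"
    unfolding sum.distrib[symmetric] by (rule sum.cong) auto
  also have "\<dots> = (\<Sum>k = 1..n div 2. 2 * (if 2 * k = n then f k / 2 else f k))"
    by (rule sum.mono_neutral_right) (use \<open>f 0 = 0\<close> in \<open>auto simp: Suc_le_eq\<close>)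
  finally show ?thesis by (simp only: sum_distrib_left)
qed

lemma unity_value_eq_sigma:
  assumes "p \<noteq> 0" "trim p" "palindromic p"
  shows "unity_value p j = 2 * (\<Sum>k = 1..darga p div 2.
           cos (2 * pi * real j * real k / real (darga p)) * sigma_coeff p k)"
proof -
  define n where "n = darga p"
  have d: "degree p < n" using degree_less_darga[OF assms(1,2)] by (simp add: n_def)
  define f where "f i = coeff p i * cos (2 * pi * real j * real i / real n)" for i
  have "f i = f (n - i)" if "i \<le> n" for i
  proof -
    \<comment> \<open>Replacing \<open>i\<close> by \<open>n - i\<close> negates the angle up to the
      full turns \<open>2 * pi * real j\<close>, which leaves the cosine unchanged.\<close>
    have "2 * pi * real j * real (n - i) / real n = 2 * pi * real j - 2 * pi * real j * real i / real n"
      using that d by (simp add: field_simps)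
    moreover have "cos (2 * pi * real j) = 1" "sin (2 * pi * real j) = 0"
      using cos_2npi[of j] sin_2npi[of j] by (simp_all only: mult.assoc mult.commute mult.left_commute)
    ultimately have "cos (2 * pi * real j * real (n - i) / real n) = cos (2 * pi * real j * real i / real n)"
      by (simp only: cos_diff)
    moreover have "coeff p i = coeff p (n - i)"
      using assms(3) that unfolding palindromic_def n_def by blast
    ultimately show ?thesis by (simp only: f_def)
  qed
  moreover have "f 0 = 0" using \<open>trim p\<close> by (simp add: f_def trim_def poly_0_coeff_0)
  ultimately have "(\<Sum>i\<le>n. f i) = 2 * (\<Sum>k = 1..n div 2. if 2 * k = n then f k / 2 else f k)"
    by (rule sum_symmetric)
  also have "\<dots> = 2 * (\<Sum>k = 1..n div 2. cos (2 * pi * real j * real k / real n) * sigma_coeff p k)"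
    by (intro arg_cong2[where f = "(*)"] sum.cong) (auto simp: f_def sigma_coeff_def n_def)
  finally show ?thesis
    using d by (simp add: unity_value_eq f_def n_def)
qed

section \<open>The threshold and its two formulas\<close>

lemma interlace_number_eq:
  assumes "p \<noteq> 0" "trim p" "palindromic p"
  shows "interlace_number p = 1 / 2 * Max ((\<lambda>j. - unity_value p j) ` {0..darga p div 2})"
proof -
  define n where "n = darga p"
  define M where "M = 1 / 2 * Max ((\<lambda>j. - unity_value p j) ` {0..n div 2})"
  have n: "n > 0" using degree_less_darga[OF assms(1,2)] by (simp add: n_def)
  have M_less_iff: "M < \<alpha> \<longleftrightarrow> (\<forall>j<n. 0 < 2 * \<alpha> + unity_value p j)" for \<alpha>
  proof -
    have "M < \<alpha> \<longleftrightarrow> Max ((\<lambda>j. - unity_value p j) ` {0..n div 2}) < 2 * \<alpha>"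
      by (auto simp: M_def)
    also have "\<dots> \<longleftrightarrow> (\<forall>j\<in>{0..n div 2}. - unity_value p j < 2 * \<alpha>)"
      by (subst Max_less_iff) auto
    also have "\<dots> \<longleftrightarrow> (\<forall>j<n. 0 < 2 * \<alpha> + unity_value p j)"
    proof (intro iffI allI impI ballI)
      fix j assume *: "\<forall>j\<in>{0..n div 2}. - unity_value p j < 2 * \<alpha>" "j < n"
      show "0 < 2 * \<alpha> + unity_value p j"
      proof (cases "j \<le> n div 2")
        case True
        then show ?thesis using bspec[OF *(1), of j] by simp
      next
        case False
        then have "n - j \<in> {0..n div 2}" by auto
        then show ?thesis
          using bspec[OF *(1), of "n - j"] unity_value_reflect[of j p] *(2) by (simp add: n_def)
      qed
    next
      fix j assume *: "\<forall>j<n. 0 < 2 * \<alpha> + unity_value p j" "j \<in> {0..n div 2}"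
      then have "j < n" using n by auto
      then show "- unity_value p j < 2 * \<alpha>" using *(1) by fastforce
    qed
    finally show ?thesis .
  qed
  have "M > 0"
  proof -
    obtain j where "j < n" "unity_value p j < 0"
      using unity_value_neg[OF assms] by (auto simp: n_def)
    \<comment> \<open>Taking \<open>\<alpha>\<close> equal to the bound gives
      \<open>M \<ge> - unity_value p j / 2\<close>, which is positive.\<close>
    then have "\<not> M < \<alpha>" if "\<alpha> \<le> - unity_value p j / 2" for \<alpha>
      using that unfolding M_less_iff by (auto simp: not_less intro!: exI[of _ j])
    from this[OF order_refl] show ?thesis using \<open>unity_value p j < 0\<close> by simp
  qed
  then have "\<alpha> > 0 \<and> strictly_angle_interlaces_U (p_shift p \<alpha>) (darga p) \<longleftrightarrow> M < \<alpha>" for \<alpha>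
    using strictly_angle_interlaces_p_shift_iff[OF assms, of \<alpha>] unfolding M_less_iff[of \<alpha>, unfolded n_def, symmetric]
    by (metis less_trans)
  \<comment> \<open>The admissible shifts form an open ray, so the infimum is \<open>M\<close> and
    is not attained.\<close>
  then have "{\<alpha>. \<alpha> > 0 \<and> strictly_angle_interlaces_U (p_shift p \<alpha>) (darga p)} = {M<..}"
    by (simp add: set_eq_iff)
  then show ?thesis
    by (simp add: interlace_number_def M_def n_def)
qed

theorem mainTheorem4:
  fixes p :: "real poly" and n :: nat
  assumes "p \<noteq> 0" and "trim p" and "palindromic p" and "darga p = n"
  shows "interlace_number p
           = 1 / 2 * Max {- Re (poly (map_poly complex_of_real p) \<omega>) | \<omega>. \<omega> \<in> V_pts n}
       \<and> interlace_number p
           = Max {(\<Sum>k = 1..n div 2. - cos (2 * pi * real j * real k / real n) * sigma_coeff p k)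
                  | j. j \<in> {0..n div 2}}"
proof
  note il = interlace_number_eq[OF assms(1-3), unfolded assms(4)]
  have "real k \<le> real n / 2 \<longleftrightarrow> k \<in> {0..n div 2}" for k
    by (simp add: less_eq_div_iff_mult_less_eq) linarith
  then have "V_pts n = (\<lambda>k. theta n ^ k) ` {0..n div 2}"
    by (auto simp: V_pts_def)
  then have "{- Re (poly (complex_poly p) \<omega>) | \<omega>. \<omega> \<in> V_pts n} = (\<lambda>j. - unity_value p j) ` {0..n div 2}"
    by (simp add: Setcompr_eq_image image_image unity_value_def assms(4))
  then show "interlace_number p = 1 / 2 * Max {- Re (poly (complex_poly p) \<omega>) | \<omega>. \<omega> \<in> V_pts n}"
    by (simp only: il)
  \<comment> \<open>Halving is monotone and so passes inside the maximum, where it cancels the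
    factor 2 of \<open>unity_value_eq_sigma\<close>.\<close>
  have "1 / 2 * Max ((\<lambda>j. - unity_value p j) ` {0..n div 2})
          = Max ((\<lambda>x. 1 / 2 * x) ` (\<lambda>j. - unity_value p j) ` {0..n div 2})"
    by (rule mono_Max_commute[of "\<lambda>x. 1 / 2 * x"]) (auto simp: mono_def)
  also have "(\<lambda>x. 1 / 2 * x) ` (\<lambda>j. - unity_value p j) ` {0..n div 2}
      = (\<lambda>j. \<Sum>k = 1..n div 2. - cos (2 * pi * real j * real k / real n) * sigma_coeff p k) ` {0..n div 2}"
    by (simp add: image_image unity_value_eq_sigma[OF assms(1-3)] assms(4) sum_negf)
  finally show "interlace_number p
           = Max {(\<Sum>k = 1..n div 2. - cos (2 * pi * real j * real k / real n) * sigma_coeff p k)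
                  | j. j \<in> {0..n div 2}}"
    unfolding il Setcompr_eq_image .
qed

end
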